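(* Every pre-symplectic left-symmetric algebra over an algebraically closed field $\mathbb{K}$ is either a Milnor pre-symplectic algebra or can be obtained by a finite sequence of double extensions by one-dimensional commutative associative algebras starting from a Milnor pre-symplectic algebra. That is, if it is not a Milnor pre-symplectic algebra, there exist $n\ge1$ and pre-symplectic left-symmetric algebras $\mathcal{A}_0,\dots,\mathcal{A}_n$ such that $\mathcal{A}_0$ is a Milnor pre-symplectic algebra, each $\mathcal{A}_k$ ($1\le k\le n$) is a double extension of $\mathcal{A}_{k-1}$ by a one-dimensional commutative associative algebra, and $\mathcal{A}_n$ is the given algebra.
   Context: $\mathbb{K}$ has characteristic $0$; all vector spaces are finite-dimensional. $[u,v]_\bullet=u\bullet v-v\bullet u$. A pre-symplectic left-symmetric algebra is a triple $(\mathcal{A},\bullet,\omega)$ where $(u\bullet v)\bullet w-u\bullet(v\bullet w)=(v\bullet u)\bullet w-v\bullet(u\bullet w)$ and $\omega$ is a nondegenerate skew-symmetric bilinear form with $\omega(u\bullet v,w)=\omega(v,u\bullet w)$ for all $u,v,w$. The zero-dimensional algebra is allowed. A Milnor pre-symplectic algebra is an algebra $(\mathcal{A},\bullet)$ with a nondegenerate skew-symmetric bilinear form $\omega$ such that $\omega(u\bullet v,w)=\omega(v,u\bullet w)$ for all $u,v,w$, $[\cdot,\cdot]_\bullet$ is a Lie bracket, and there is a two-sided ideal $I$, nondegenerate ($I\cap I^\perp=\{0\}$), with $\mathcal{A}\bullet\mathcal{A}\subset I$ and $u\bullet v=0$ for all $u\in I$, $v\in\mathcal{A}$. The zero algebra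 is Milnor. Double extension by a one-dimensional algebra $\mathfrak{h}=\mathbb{K}d$, $d\circ d=\lambda d$: data on $(\mathcal{B},\bullet_{\mathcal{B}},\omega_{\mathcal{B}})$ are $\xi,D\in\mathrm{End}(\mathcal{B})$, $b_0\in\mathcal{B}$, $\lambda\in\mathbb{K}$, with $\xi$ symmetric w.r.t. $\omega_{\mathcal{B}}$ and, for all $u,v\in\mathcal{B}$ (writing $\bullet$ for $\bullet_{\mathcal{B}}$, $T^*$ for the adjoint w.r.t. $\omega_{\mathcal{B}}$): $D([u,v]_\bullet)=0$; $u\bullet D(v)=v\bullet D(u)$; $D(u)\bullet v=\xi(u)\bullet v$; $\xi(u\bullet v)=u\bullet\xi(v)$; $\xi(D(u))=\lambda D(u)+u\bullet b_0$; $D^2=D\circ\xi$; $D^*\circ D=0$; $D^*(b_0)=0$. The double extension is $\mathbb{K}d\oplus\mathcal{B}\oplus\mathbb{K}e$ with $d\bullet e=\lambda e$, $d\bullet u=\xi(u)-\omega_{\mathcal{B}}(b_0,u)e$, $u\bullet d=D(u)$, $d\bullet d=\lambda d+b_0$, $u\bullet v=u\bullet_{\mathcal{B}}v-\omega_{\mathcal{B}}(D(u),v)e$, other products ($e\bullet x$, $u\bullet e$) zero, and $\omega|_{\mathcal{B}\times\mathcal{B}}=\omega_{\mathcal{B}}$, $\omega(e,d)=-\omega(d,e)=1$, $\omega(d,\mathcal{B})=\omega(e,\mathcal{B})=0$. "Is a double extension" means isomorphic to such an algebra by an algebra isomorphism preserving the forms. *)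

theory Defs
  imports "HOL-Computational_Algebra.Computational_Algebra" "HOL-Library.Product_Plus"
begin

text \<open>
  The underlying space of an algebra is a finite-dimensional subspace of an ambient vector space,
  so that algebras of different dimensions can live in one type. All conditions are relativised to
  that subspace; the values of the operations outside it are irrelevant.
\<close>

record ('k, 'v) form_algebra =
  carrier :: "'v set"
  scale :: "'k \<Rightarrow> 'v \<Rightarrow> 'v"
  mult :: "'v \<Rightarrow> 'v \<Rightarrow> 'v"
  form :: "'v \<Rightarrow> 'v \<Rightarrow> 'k"

definition linear_on ::
  "('k::field \<Rightarrow> 'v::ab_group_add \<Rightarrow> 'v) \<Rightarrow> 'v set \<Rightarrow> ('k \<Rightarrow> 'w::ab_group_add \<Rightarrow> 'w) \<Rightarrow> 'w set
    \<Rightarrow> ('v \<Rightarrow> 'w) \<Rightarrow> bool" where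
  "linear_on s V t W f \<longleftrightarrow>
     (\<forall>u\<in>V. f u \<in> W) \<and>
     (\<forall>u\<in>V. \<forall>v\<in>V. f (u + v) = f u + f v) \<and>
     (\<forall>c. \<forall>u\<in>V. f (s c u) = t c (f u))"

definition bilinear_on ::
  "('k::field \<Rightarrow> 'v::ab_group_add \<Rightarrow> 'v) \<Rightarrow> 'v set \<Rightarrow> ('k \<Rightarrow> 'w::ab_group_add \<Rightarrow> 'w) \<Rightarrow> 'w set
    \<Rightarrow> ('v \<Rightarrow> 'v \<Rightarrow> 'w) \<Rightarrow> bool" where
  "bilinear_on s V t W f \<longleftrightarrow>
     (\<forall>u\<in>V. linear_on s V t W (f u)) \<and> (\<forall>v\<in>V. linear_on s V t W (\<lambda>u. f u v))"

definition fd_algebra :: "('k::field, 'v::ab_group_add) form_algebra \<Rightarrow> bool" where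
  "fd_algebra A \<longleftrightarrow>
     vector_space (scale A) \<and>
     (\<exists>S. finite S \<and> carrier A = module.span (scale A) S) \<and>
     bilinear_on (scale A) (carrier A) (scale A) (carrier A) (mult A)"

definition symplectic_form :: "('k::field, 'v::ab_group_add) form_algebra \<Rightarrow> bool" where
  "symplectic_form A \<longleftrightarrow>
     bilinear_on (scale A) (carrier A) (*) UNIV (form A) \<and>
     (\<forall>u\<in>carrier A. \<forall>v\<in>carrier A. form A u v = - form A v u) \<and>
     (\<forall>u\<in>carrier A. (\<forall>v\<in>carrier A. form A u v = 0) \<longrightarrow> u = 0)"

definition left_mult_symmetric :: "('k, 'v) form_algebra \<Rightarrow> bool" where
  "left_mult_symmetric A \<longleftrightarrow>
     (\<forall>u\<in>carrier A. \<forall>v\<in>carrier A. \<forall>w\<in>carrier A.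
        form A (mult A u v) w = form A v (mult A u w))"

definition left_symmetric :: "('k, 'v::ab_group_add) form_algebra \<Rightarrow> bool" where
  "left_symmetric A \<longleftrightarrow>
     (\<forall>u\<in>carrier A. \<forall>v\<in>carrier A. \<forall>w\<in>carrier A.
        mult A (mult A u v) w - mult A u (mult A v w) =
        mult A (mult A v u) w - mult A v (mult A u w))"

definition presymplectic_lsa :: "('k::field, 'v::ab_group_add) form_algebra \<Rightarrow> bool" where
  "presymplectic_lsa A \<longleftrightarrow>
     fd_algebra A \<and> left_symmetric A \<and> symplectic_form A \<and> left_mult_symmetric A"

definition comm :: "('k, 'v::ab_group_add) form_algebra \<Rightarrow> 'v \<Rightarrow> 'v \<Rightarrow> 'v" where
  "comm A u v = mult A u v - mult A v u"

definition lie_bracket_on ::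
  "('k::field \<Rightarrow> 'v::ab_group_add \<Rightarrow> 'v) \<Rightarrow> 'v set \<Rightarrow> ('v \<Rightarrow> 'v \<Rightarrow> 'v) \<Rightarrow> bool" where
  "lie_bracket_on s V br \<longleftrightarrow>
     bilinear_on s V s V br \<and>
     (\<forall>u\<in>V. br u u = 0) \<and>
     (\<forall>u\<in>V. \<forall>v\<in>V. \<forall>w\<in>V. br u (br v w) + br v (br w u) + br w (br u v) = 0)"

definition two_sided_ideal :: "('k::field, 'v::ab_group_add) form_algebra \<Rightarrow> 'v set \<Rightarrow> bool" where
  "two_sided_ideal A I \<longleftrightarrow>
     I \<subseteq> carrier A \<and> module.subspace (scale A) I \<and>
     (\<forall>u\<in>carrier A. \<forall>v\<in>I. mult A u v \<in> I \<and> mult A v u \<in> I)"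

definition orthogonal :: "('k::zero, 'v) form_algebra \<Rightarrow> 'v set \<Rightarrow> 'v set" where
  "orthogonal A I = {u \<in> carrier A. \<forall>v\<in>I. form A u v = 0}"

definition milnor_presymplectic :: "('k::field, 'v::ab_group_add) form_algebra \<Rightarrow> bool" where
  "milnor_presymplectic A \<longleftrightarrow>
     fd_algebra A \<and> symplectic_form A \<and> left_mult_symmetric A \<and>
     lie_bracket_on (scale A) (carrier A) (comm A) \<and>
     (\<exists>I. two_sided_ideal A I \<and> I \<inter> orthogonal A I = {0} \<and>
        (\<forall>u\<in>carrier A. \<forall>v\<in>carrier A. mult A u v \<in> I) \<and>
        (\<forall>u\<in>I. \<forall>v\<in>carrier A. mult A u v = 0))"

definition endo :: "('k::field, 'v::ab_group_add) form_algebra \<Rightarrow> ('v \<Rightarrow> 'v) \<Rightarrow> bool" where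
  "endo A T \<longleftrightarrow> linear_on (scale A) (carrier A) (scale A) (carrier A) T"

text \<open>
  The description is proper on the carrier for an endomorphism of a finite-dimensional space with
  nondegenerate form.
\<close>

definition adjoint :: "('k, 'v) form_algebra \<Rightarrow> ('v \<Rightarrow> 'v) \<Rightarrow> 'v \<Rightarrow> 'v" where
  "adjoint A T v =
     (THE w. w \<in> carrier A \<and> (\<forall>u\<in>carrier A. form A (T u) v = form A u w))"

definition symmetric_endo :: "('k, 'v) form_algebra \<Rightarrow> ('v \<Rightarrow> 'v) \<Rightarrow> bool" where
  "symmetric_endo A T \<longleftrightarrow>
     (\<forall>u\<in>carrier A. \<forall>v\<in>carrier A. form A (T u) v = form A u (T v))"

definition double_extension_data ::
  "('k::field, 'v::ab_group_add) form_algebra \<Rightarrow> ('v \<Rightarrow> 'v) \<Rightarrow> ('v \<Rightarrow> 'v) \<Rightarrow> 'v \<Rightarrow> 'k \<Rightarrow> bool" where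
  "double_extension_data B \<xi> D b\<^sub>0 lam \<longleftrightarrow>
     endo B \<xi> \<and> endo B D \<and> b\<^sub>0 \<in> carrier B \<and> symmetric_endo B \<xi> \<and>
     (\<forall>u\<in>carrier B. \<forall>v\<in>carrier B.
        D (comm B u v) = 0 \<and>
        mult B u (D v) = mult B v (D u) \<and>
        mult B (D u) v = mult B (\<xi> u) v \<and>
        \<xi> (mult B u v) = mult B u (\<xi> v)) \<and>
     (\<forall>u\<in>carrier B.
        \<xi> (D u) = scale B lam (D u) + mult B u b\<^sub>0 \<and>
        D (D u) = D (\<xi> u) \<and>
        adjoint B D (D u) = 0) \<and>
     adjoint B D b\<^sub>0 = 0"

text \<open>The triple \<open>(a, u, c)\<close> stands for \<open>a d + u + c e\<close>.\<close>

definition double_extension ::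
  "('k::field, 'v::ab_group_add) form_algebra \<Rightarrow> ('v \<Rightarrow> 'v) \<Rightarrow> ('v \<Rightarrow> 'v) \<Rightarrow> 'v \<Rightarrow> 'k
    \<Rightarrow> ('k, 'k \<times> 'v \<times> 'k) form_algebra" where
  "double_extension B \<xi> D b\<^sub>0 lam =
     \<lparr> carrier = UNIV \<times> carrier B \<times> UNIV,
       scale = (\<lambda>r (a, u, c). (r * a, scale B r u, r * c)),
       mult = (\<lambda>(a, u, c) (a', u', c').
         (lam * a * a',
          scale B (a * a') b\<^sub>0 + scale B a (\<xi> u') + scale B a' (D u) + mult B u u',
          lam * a * c' - a * form B b\<^sub>0 u' - form B (D u) u')),
       form = (\<lambda>(a, u, c) (a', u', c'). form B u u' + c * a' - a * c') \<rparr>"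

definition isomorphic ::
  "('k::field, 'v::ab_group_add) form_algebra \<Rightarrow> ('k, 'w::ab_group_add) form_algebra \<Rightarrow> bool" where
  "isomorphic A B \<longleftrightarrow>
     (\<exists>f. linear_on (scale A) (carrier A) (scale B) (carrier B) f \<and>
        bij_betw f (carrier A) (carrier B) \<and>
        (\<forall>u\<in>carrier A. \<forall>v\<in>carrier A.
           f (mult A u v) = mult B (f u) (f v) \<and> form B (f u) (f v) = form A u v))"

definition is_double_extension ::
  "('k::field, 'v::ab_group_add) form_algebra \<Rightarrow> ('k, 'w::ab_group_add) form_algebra \<Rightarrow> bool" where
  "is_double_extension A B \<longleftrightarrow>
     (\<exists>\<xi> D b\<^sub>0 lam. double_extension_data B \<xi> D b\<^sub>0 lam \<and>
        isomorphic A (double_extension B \<xi> D b\<^sub>0 lam))"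

end

theory Submission
  imports Defs
begin

text \<open>
  Left multiplications of a pre-symplectic left-symmetric algebra commute with each other.
  Indeed, left symmetry says that \<open>L\<close> of a commutator \<open>[u, v]\<close> equals \<open>L\<^sub>u L\<^sub>v - L\<^sub>v L\<^sub>u\<close>;
  the first is symmetric for \<open>\<omega>\<close> and the second antisymmetric, so both are zero
  (\<open>prd_comm_left\<close>, \<open>left_mults_commute\<close>). Hence the ideal \<open>N\<close> of the elements with zero left
  multiplication (\<open>kernel\<close>) contains all commutators. Let \<open>M\<close> (\<open>core\<close>) consist of the elements
  of \<open>N\<close> that are orthogonal to all commutators; it is invariant under left multiplications.

  If \<open>M = 0\<close>, then \<open>N\<close> is nondegenerate, and the products of elements of its orthogonal
  complement vanish, since there \<open>\<omega> (x \<bullet> y) z\<close> is symmetric in \<open>x, y\<close> and antisymmetric in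
  \<open>y, z\<close>. So \<open>N\<close> is an ideal as in the definition of a Milnor algebra
  (\<open>milnor_if_core_trivial\<close>).

  If \<open>M \<noteq> 0\<close>, the commuting left multiplications have a common eigenvector \<open>e\<close> in \<open>M\<close>; this is
  where algebraic closedness enters (\<open>common_eigenvector_exists\<close>). Orthogonality of \<open>e\<close> to
  commutators forces the weight of \<open>e\<close> to be a multiple of \<open>\<omega> e\<close> (\<open>eigenvector_in_core\<close>), and
  this is what is needed for the algebra to be a double extension of the complement
  \<open>{d, e}\<^sup>\<bottom>\<close> of the line of \<open>e\<close> in \<open>e\<^sup>\<bottom>\<close>, where \<open>\<omega> e d = 1\<close>: the data
  \<open>\<xi>\<close>, \<open>D\<close>, \<open>b\<^sub>0\<close> are read off from the products with \<open>d\<close>, and the algebraic conditions on them are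
  instances of the two commutation laws (\<open>B_data\<close>, \<open>is_double_extension\<close>). The smaller algebra has smaller
  dimension, so induction finishes the proof.
\<close>

section \<open>Linear algebra on subspaces\<close>

lemma linear_onD:
  assumes "linear_on s V t W f"
  shows "u \<in> V \<Longrightarrow> f u \<in> W" "u \<in> V \<Longrightarrow> v \<in> V \<Longrightarrow> f (u + v) = f u + f v"
    "u \<in> V \<Longrightarrow> f (s c u) = t c (f u)"
  using assms by (auto simp: linear_on_def)

lemma bilinear_onD:
  assumes "bilinear_on s V t W f" "u \<in> V" "v \<in> V" "w \<in> V"
  shows "f u v \<in> W" "f (u + v) w = f u w + f v w" "f u (v + w) = f u v + f u w"
    "f (s c u) v = t c (f u v)" "f u (s c v) = t c (f u v)"
  using assms by (auto simp: bilinear_on_def linear_on_def)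

lemma (in vector_space) subspace_obtain_basis:
  assumes "finite S" "subspace U" "U \<subseteq> span S"
  obtains B where "finite B" "independent B" "span B = U" "card B \<le> card S"
proof -
  obtain B where B: "B \<subseteq> U" "independent B" "U \<subseteq> span B"
    using maximal_independent_subset by blast
  then have "span B = U"
    using assms(2) span_minimal by blast
  then show thesis
    using that B independent_span_bound[OF assms(1), of B] assms(3) by blast
qed

text \<open>A basis of the smaller space stays independent when a vector outside that space is added.\<close>

lemma (in vector_space) proper_subspace_obtain_basis:
  assumes "finite S" "subspace U" "U \<subseteq> span S" "x \<in> span S" "x \<notin> U"
  obtains B where "finite B" "span B = U" "card B < card S"
proof -
  obtain B where B: "finite B" "independent B" "span B = U" "card B \<le> card S"
    using subspace_obtain_basis assms(1-3) by blast
  have "independent (insert x B)"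
    using B assms(5) by (simp add: independent_insertI)
  moreover have "insert x B \<subseteq> span S"
    using assms(3,4) B(3) span_superset by blast
  ultimately have "card (insert x B) \<le> card S"
    using independent_span_bound[OF assms(1)] by blast
  moreover have "x \<notin> B"
    using B(3) assms(5) span_base by blast
  ultimately show thesis
    using that B by simp
qed

section \<open>Common eigenvectors\<close>

text \<open>
  The vector \<open>p(f) v\<close>. Horner's scheme turns the computation rules into inductions over the
  coefficients that use linearity of \<open>f\<close> only on vectors of the same form, which stay in the
  subspace where \<open>f\<close> is linear.
\<close>

definition poly_act ::
  "('k::field \<Rightarrow> 'v::ab_group_add \<Rightarrow> 'v) \<Rightarrow> ('v \<Rightarrow> 'v) \<Rightarrow> 'v \<Rightarrow> 'k poly \<Rightarrow> 'v" where
  "poly_act s f v p = fold_coeffs (\<lambda>a w. s a v + f w) p 0"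

locale endo_on = vector_space s for s :: "'k::field \<Rightarrow> 'v::ab_group_add \<Rightarrow> 'v" +
  fixes W :: "'v set" and f :: "'v \<Rightarrow> 'v" and v :: 'v
  assumes W: "subspace W" and f: "linear_on s W s W f" and v: "v \<in> W"
begin

lemma f_zero: "f 0 = 0"
  using linear_onD(3)[OF f v, of 0] by simp

lemma poly_act_0 [simp]: "poly_act s f v 0 = 0"
  by (simp add: poly_act_def)

lemma poly_act_pCons [simp]: "poly_act s f v (pCons a p) = s a v + f (poly_act s f v p)"
  by (cases "a = 0 \<and> p = 0") (auto simp: poly_act_def f_zero)

lemma poly_act_in: "poly_act s f v p \<in> W"
  by (induction p) (auto simp: subspace_0[OF W] v intro!: subspace_add[OF W] subspace_scale[OF W]
      linear_onD(1)[OF f])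

lemma poly_act_add: "poly_act s f v (p + q) = poly_act s f v p + poly_act s f v q"
  by (induction p q rule: poly_induct2)
    (auto simp: linear_onD(2)[OF f] poly_act_in scale_left_distrib)

lemma poly_act_smult: "poly_act s f v (smult c p) = s c (poly_act s f v p)"
  by (induction p) (auto simp: linear_onD(3)[OF f] poly_act_in scale_right_distrib)

lemma poly_act_monom: "poly_act s f v (monom 1 k) = (f ^^ k) v"
  by (induction k) (auto simp: monom_0 monom_Suc f_zero)

text \<open>
  In a finite-dimensional space some \<open>f\<^sup>k v\<close> depends on the lower iterates, which are the values
  at \<open>v\<close> of the polynomials in \<open>f\<close> of degree less than \<open>k\<close>.
\<close>

lemma annihilating_poly:
  assumes "finite S" "W = span S"
  obtains p where "p \<noteq> 0" "poly_act s f v p = 0"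
proof -
  define U where "U k = (\<lambda>i. (f ^^ i) v) ` {..<k}" for k
  have "\<exists>k. (f ^^ k) v \<in> span (U k)"
  proof (rule ccontr)
    assume *: "\<not> ?thesis"
    have "finite (U k) \<and> independent (U k) \<and> card (U k) = k" for k
    proof (induction k)
      case 0
      then show ?case by (simp add: U_def independent_empty)
    next
      case (Suc k)
      have "U (Suc k) = insert ((f ^^ k) v) (U k)"
        by (simp add: U_def lessThan_Suc)
      moreover have "(f ^^ k) v \<notin> U k"
        using * span_base by blast
      ultimately show ?case
        using Suc * by (simp add: independent_insertI)
    qed
    moreover have "U (Suc (card S)) \<subseteq> span S"
      unfolding U_def assms(2)[symmetric] by (auto simp: poly_act_monom[symmetric] poly_act_in)
    ultimately show False
      using independent_span_bound[OF assms(1), of "U (Suc (card S))"] by auto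
  qed
  then obtain k where k: "(f ^^ k) v \<in> span (U k)"
    by blast
  let ?P = "poly_act s f v ` {p. \<forall>i\<ge>k. coeff p i = 0}"
  have "U k \<subseteq> ?P"
    unfolding U_def by (auto simp: poly_act_monom[symmetric] intro!: image_eqI)
  moreover have "subspace ?P"
  proof (rule subspaceI)
    show "0 \<in> ?P"
      by (rule image_eqI[of _ _ 0]) auto
  next
    fix x y assume "x \<in> ?P" "y \<in> ?P"
    then obtain p q where "x = poly_act s f v p" "y = poly_act s f v q"
      "\<forall>i\<ge>k. coeff p i = 0" "\<forall>i\<ge>k. coeff q i = 0"
      by auto
    then show "x + y \<in> ?P"
      by (intro image_eqI[of _ _ "p + q"]) (auto simp: poly_act_add)
  next
    fix c x assume "x \<in> ?P"
    then obtain p where "x = poly_act s f v p" "\<forall>i\<ge>k. coeff p i = 0"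
      by auto
    then show "s c x \<in> ?P"
      by (intro image_eqI[of _ _ "smult c p"]) (auto simp: poly_act_smult)
  qed
  ultimately have "span (U k) \<subseteq> ?P"
    by (rule span_minimal)
  then obtain p where p: "(f ^^ k) v = poly_act s f v p" "coeff p k = 0"
    using k by auto
  have "poly_act s f v (monom 1 k + smult (-1) p) = 0"
    using p(1) unfolding poly_act_add poly_act_smult poly_act_monom by simp
  moreover have "coeff (monom 1 k + smult (-1) p) k \<noteq> 0"
    using p(2) by simp
  then have "monom 1 k + smult (-1) p \<noteq> 0"
    by (metis coeff_0)
  ultimately show thesis
    using that by blast
qed

end

text \<open>
  Let \<open>p\<close> be nonzero of least degree with \<open>p(f) v = 0\<close>. Then \<open>p = (X - c) q\<close>, and \<open>q(f) v\<close> is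
  an eigenvector: it is nonzero by minimality.
\<close>

lemma eigenvector_exists:
  fixes s :: "'k::alg_closed_field \<Rightarrow> 'v::ab_group_add \<Rightarrow> 'v"
  assumes "vector_space s" "finite S" "W = module.span s S" "linear_on s W s W f" "W \<noteq> {0}"
  obtains c w where "w \<in> W" "w \<noteq> 0" "f w = s c w"
proof -
  interpret vector_space s by fact
  have "subspace W"
    using assms(3) by simp
  then obtain v where "v \<in> W" "v \<noteq> 0"
    using assms(5) subspace_0 by blast
  interpret endo_on s W f v
    by unfold_locales (use \<open>subspace W\<close> assms(4) \<open>v \<in> W\<close> in auto)
  obtain p0 where "p0 \<noteq> 0 \<and> poly_act s f v p0 = 0"
    using annihilating_poly assms(2,3) by blast
  from ex_has_least_nat[of "\<lambda>p. p \<noteq> 0 \<and> poly_act s f v p = 0", OF this, of degree]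
  obtain p where p: "p \<noteq> 0" "poly_act s f v p = 0"
    and least: "\<And>q. q \<noteq> 0 \<Longrightarrow> poly_act s f v q = 0 \<Longrightarrow> degree p \<le> degree q"
    by blast
  have "degree p > 0"
  proof (rule ccontr)
    assume "\<not> degree p > 0"
    then obtain a where "p = [:a:]"
      by (metis degree_eq_zeroE gr0I)
    then show False
      using p \<open>v \<noteq> 0\<close> f_zero by auto
  qed
  then obtain c where "poly p c = 0"
    using alg_closed_imp_poly_has_root by blast
  then obtain q where q: "p = [:-c, 1:] * q"
    by (auto simp: poly_eq_0_iff_dvd)
  with p have "q \<noteq> 0"
    by auto
  then have "degree p = Suc (degree q)"
    unfolding q by (subst degree_mult_eq) auto
  then have "poly_act s f v q \<noteq> 0"
    using least[of q] \<open>q \<noteq> 0\<close> by auto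
  moreover have "p = smult (-c) q + pCons 0 q"
    by (simp add: q)
  then have "f (poly_act s f v q) = s c (poly_act s f v q)"
    using p(2) by (simp add: poly_act_add poly_act_smult del: smult_minus_left)
  ultimately show thesis
    by (rule that[OF poly_act_in])
qed

text \<open>
  If the maps \<open>L x\<close> do not all act as scalars, an eigenspace of one of them is a proper subspace,
  and it is invariant because the maps commute.
\<close>

lemma common_eigenvector_exists:
  fixes s :: "'k::alg_closed_field \<Rightarrow> 'v::ab_group_add \<Rightarrow> 'v"
  assumes "vector_space s" "finite S" "W = module.span s S" "W \<noteq> {0}"
    and "\<And>x. x \<in> X \<Longrightarrow> linear_on s W s W (L x)"
    and "\<And>x y w. x \<in> X \<Longrightarrow> y \<in> X \<Longrightarrow> w \<in> W \<Longrightarrow> L x (L y w) = L y (L x w)"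
  shows "\<exists>w\<in>W. w \<noteq> 0 \<and> (\<forall>x\<in>X. \<exists>c. L x w = s c w)"
  using assms(2-)
proof (induction "card S" arbitrary: S W rule: less_induct)
  case less
  interpret vector_space s by fact
  have W: "subspace W"
    using less.prems(2) by simp
  obtain v where v: "v \<in> W" "v \<noteq> 0"
    using less.prems(3) subspace_0[OF W] by blast
  show ?case
  proof (cases "\<forall>x\<in>X. \<exists>c. \<forall>w\<in>W. L x w = s c w")
    case True
    then show ?thesis
      using v by blast
  next
    case False
    then obtain x where x: "x \<in> X" "\<And>c. \<exists>w\<in>W. L x w \<noteq> s c w"
      by blast
    obtain c w where w: "w \<in> W" "w \<noteq> 0" "L x w = s c w"
      using eigenvector_exists[OF assms(1) less.prems(1,2) less.prems(4)[OF x(1)] less.prems(3)] .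
    obtain z where z: "z \<in> W" "L x z \<noteq> s c z"
      using x(2) by blast
    let ?E = "{u \<in> W. L x u = s c u}"
    note lin = linear_onD[OF less.prems(4)]
    have "L x 0 = 0"
      using lin(3)[OF x(1) v(1), of 0] by simp
    then have E: "subspace ?E"
      using W lin[OF x(1)]
      by (auto simp: subspace_def scale_right_distrib scale_left_commute)
    obtain B where B: "finite B" "span B = ?E" "card B < card S"
      using proper_subspace_obtain_basis[OF less.prems(1) E, of z] z less.prems(2) by auto
    have "linear_on s ?E s ?E (L y)" if "y \<in> X" for y
      using that lin[OF that] less.prems(5)[OF x(1) that] subspace_add[OF E] subspace_scale[OF E]
      by (auto simp: linear_on_def)
    moreover have "?E \<noteq> {0}"
      using w by blast
    ultimately have "\<exists>u\<in>?E. u \<noteq> 0 \<and> (\<forall>x\<in>X. \<exists>c. L x u = s c u)"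
      using less.hyps[OF B(3,1) B(2)[symmetric]] less.prems(5) by auto
    then show ?thesis
      by blast
  qed
qed

section \<open>Pre-symplectic left-symmetric algebras\<close>

locale presymplectic =
  fixes A :: "('k::field_char_0, 'v::ab_group_add) form_algebra"
  assumes presymplectic_lsa: "presymplectic_lsa A"
begin

abbreviation V :: "'v set" where "V \<equiv> carrier A"
abbreviation scal :: "'k \<Rightarrow> 'v \<Rightarrow> 'v" (infixr "*s" 75) where "c *s u \<equiv> scale A c u"
abbreviation prd :: "'v \<Rightarrow> 'v \<Rightarrow> 'v" (infixl "\<bullet>" 70) where "u \<bullet> v \<equiv> mult A u v"
abbreviation om :: "'v \<Rightarrow> 'v \<Rightarrow> 'k" ("\<omega>") where "\<omega> \<equiv> form A"

lemma vector_space: "vector_space (scale A)"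
  using presymplectic_lsa by (simp add: presymplectic_lsa_def fd_algebra_def)

sublocale vs: vector_space "scale A"
  by (rule vector_space)

lemma finite_span: "\<exists>S. finite S \<and> V = vs.span S"
  using presymplectic_lsa by (simp add: presymplectic_lsa_def fd_algebra_def)

lemma subspace_V: "vs.subspace V"
  using finite_span vs.subspace_span by metis

lemma bilinear_prd: "bilinear_on (scale A) V (scale A) V (mult A)"
  and bilinear_om: "bilinear_on (scale A) V (*) UNIV \<omega>"
  using presymplectic_lsa
  by (simp_all add: presymplectic_lsa_def fd_algebra_def symplectic_form_def)

lemma closed [simp]:
  "0 \<in> V" "u \<in> V \<Longrightarrow> v \<in> V \<Longrightarrow> u + v \<in> V" "u \<in> V \<Longrightarrow> c *s u \<in> V"
  "u \<in> V \<Longrightarrow> v \<in> V \<Longrightarrow> u - v \<in> V" "u \<in> V \<Longrightarrow> v \<in> V \<Longrightarrow> u \<bullet> v \<in> V"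
  using vs.subspace_0 vs.subspace_add vs.subspace_scale vs.subspace_diff subspace_V
    bilinear_onD(1)[OF bilinear_prd] by auto

lemma prd_lin [simp]:
  assumes "u \<in> V" "v \<in> V"
  shows "w \<in> V \<Longrightarrow> (u + v) \<bullet> w = u \<bullet> w + v \<bullet> w"
    "w \<in> V \<Longrightarrow> u \<bullet> (v + w) = u \<bullet> v + u \<bullet> w"
    "(c *s u) \<bullet> v = c *s (u \<bullet> v)" "u \<bullet> (c *s v) = c *s (u \<bullet> v)"
  using bilinear_onD[OF bilinear_prd] assms by auto

lemma om_lin [simp]:
  assumes "u \<in> V" "v \<in> V"
  shows "w \<in> V \<Longrightarrow> \<omega> (u + v) w = \<omega> u w + \<omega> v w"
    "w \<in> V \<Longrightarrow> \<omega> u (v + w) = \<omega> u v + \<omega> u w"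
    "\<omega> (c *s u) v = c * \<omega> u v" "\<omega> u (c *s v) = c * \<omega> u v"
  using bilinear_onD[OF bilinear_om] assms by auto

lemma zero [simp]:
  assumes "u \<in> V"
  shows "0 \<bullet> u = 0" "u \<bullet> 0 = 0" "\<omega> 0 u = 0" "\<omega> u 0 = 0"
  using prd_lin(3)[of u u 0] prd_lin(4)[of u u 0] om_lin(3)[of u u 0] om_lin(4)[of u u 0] assms
  by auto

lemma diff_lin [simp]:
  assumes "u \<in> V" "v \<in> V" "w \<in> V"
  shows "(u - v) \<bullet> w = u \<bullet> w - v \<bullet> w" "u \<bullet> (v - w) = u \<bullet> v - u \<bullet> w"
    "\<omega> (u - v) w = \<omega> u w - \<omega> v w" "\<omega> u (v - w) = \<omega> u v - \<omega> u w"
  using prd_lin(1)[of "u - v" v w] prd_lin(2)[of u "v - w" w] om_lin(1)[of "u - v" v w]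
    om_lin(2)[of u "v - w" w] assms by (auto simp: algebra_simps)

lemma om_skew: "u \<in> V \<Longrightarrow> v \<in> V \<Longrightarrow> \<omega> u v = - \<omega> v u"
  and nondegenerate: "u \<in> V \<Longrightarrow> (\<And>v. v \<in> V \<Longrightarrow> \<omega> u v = 0) \<Longrightarrow> u = 0"
  and om_prd_left: "u \<in> V \<Longrightarrow> v \<in> V \<Longrightarrow> w \<in> V \<Longrightarrow> \<omega> (u \<bullet> v) w = \<omega> v (u \<bullet> w)"
  and lsa: "u \<in> V \<Longrightarrow> v \<in> V \<Longrightarrow> w \<in> V \<Longrightarrow>
    (u \<bullet> v) \<bullet> w - u \<bullet> (v \<bullet> w) = (v \<bullet> u) \<bullet> w - v \<bullet> (u \<bullet> w)"
  using presymplectic_lsa unfolding presymplectic_lsa_def left_symmetric_def symplectic_form_def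
    left_mult_symmetric_def by blast+

lemma om_self [simp]: "u \<in> V \<Longrightarrow> \<omega> u u = 0"
  using om_skew[of u u] by simp

lemma om_prd_self [simp]: "u \<in> V \<Longrightarrow> v \<in> V \<Longrightarrow> \<omega> (u \<bullet> v) v = 0"
  using om_prd_left[of u v v] om_skew[of v "u \<bullet> v"] by simp

text \<open>
  For \<open>c = [u, v]\<close>, left symmetry says \<open>L\<^sub>c = L\<^sub>u L\<^sub>v - L\<^sub>v L\<^sub>u\<close>. The left-hand side is symmetric
  for \<open>\<omega>\<close>, whereas a commutator of symmetric maps is antisymmetric; hence both vanish.
\<close>

lemma prd_comm_left: "u \<in> V \<Longrightarrow> v \<in> V \<Longrightarrow> w \<in> V \<Longrightarrow> (u \<bullet> v) \<bullet> w = (v \<bullet> u) \<bullet> w"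
  and left_mults_commute: "u \<in> V \<Longrightarrow> v \<in> V \<Longrightarrow> w \<in> V \<Longrightarrow> u \<bullet> (v \<bullet> w) = v \<bullet> (u \<bullet> w)"
proof -
  assume uv: "u \<in> V" "v \<in> V" and w: "w \<in> V"
  let ?c = "u \<bullet> v - v \<bullet> u"
  have c: "?c \<bullet> w = u \<bullet> (v \<bullet> w) - v \<bullet> (u \<bullet> w)" if "w \<in> V" for w
    using lsa[of u v w] that uv by (simp add: algebra_simps)
  have "?c \<bullet> w = 0"
  proof (rule nondegenerate)
    fix z assume z: "z \<in> V"
    have "\<omega> (?c \<bullet> w) z = \<omega> w (?c \<bullet> z)"
      using uv w z by (intro om_prd_left) auto
    also have "\<dots> = - (\<omega> w (v \<bullet> (u \<bullet> z)) - \<omega> w (u \<bullet> (v \<bullet> z)))"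
      using c[OF z] uv w z by (simp del: diff_lin(1))
    also have "\<dots> = - \<omega> (?c \<bullet> w) z"
      using c[OF w] uv w z by (simp add: om_prd_left del: diff_lin(1))
    finally show "\<omega> (?c \<bullet> w) z = 0"
      by simp
  qed (use uv w in auto)
  then show "(u \<bullet> v) \<bullet> w = (v \<bullet> u) \<bullet> w" "u \<bullet> (v \<bullet> w) = v \<bullet> (u \<bullet> w)"
    using c[OF w] uv w by auto
qed

text \<open>
  Induction on \<open>F\<close>, for all \<open>I\<close> at once: passing to the kernel of one functional in \<open>I\<close>
  removes it from the list, at the price of correcting the result by a multiple of it.
\<close>

lemma functional_in_span:
  assumes "finite F" "F \<subseteq> V" "vs.subspace I" "I \<subseteq> V" "w \<in> V"
    and "\<And>i. i \<in> I \<Longrightarrow> (\<And>s. s \<in> F \<Longrightarrow> \<omega> i s = 0) \<Longrightarrow> \<omega> i w = 0"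
  shows "\<exists>g\<in>vs.span F. \<forall>i\<in>I. \<omega> i w = \<omega> i g"
  using assms
proof (induction F arbitrary: I w rule: finite_induct)
  case empty
  then show ?case by auto
next
  case (insert s F)
  have s: "s \<in> V" and F: "F \<subseteq> V"
    using insert.prems by auto
  have FV: "vs.span F \<subseteq> V"
    using vs.span_minimal[OF F subspace_V] .
  let ?J = "{i \<in> I. \<omega> i s = 0}"
  have J: "vs.subspace ?J"
    using insert.prems(2,3) s by (auto simp: vs.subspace_def subset_iff)
  have "\<exists>g\<in>vs.span F. \<forall>i\<in>?J. \<omega> i w = \<omega> i g"
    using insert.prems F J by (intro insert.IH) auto
  then obtain g where g: "g \<in> vs.span F" "\<And>i. i \<in> I \<Longrightarrow> \<omega> i s = 0 \<Longrightarrow> \<omega> i w = \<omega> i g"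
    by auto
  show ?case
  proof (cases "\<forall>i\<in>I. \<omega> i s = 0")
    case True
    then show ?thesis
      using g vs.span_mono[of F "insert s F"] by blast
  next
    case False
    then obtain k where k: "k \<in> I" "\<omega> k s \<noteq> 0"
      by blast
    let ?c = "\<omega> k (w - g) / \<omega> k s"
    have "\<omega> i w = \<omega> i (g + ?c *s s)" if i: "i \<in> I" for i
    proof -
      let ?j = "i - (\<omega> i s / \<omega> k s) *s k"
      have in_V: "i \<in> V" "k \<in> V" "g \<in> V" "w \<in> V"
        using i k g(1) FV insert.prems by auto
      have "?j \<in> I"
        using i k vs.subspace_diff vs.subspace_scale insert.prems(2) by auto
      moreover have "\<omega> ?j s = 0"
        using in_V s k by simp
      ultimately have "\<omega> ?j w = \<omega> ?j g"
        using g(2) by blast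
      then show ?thesis
        using in_V s k by (simp add: field_simps)
    qed
    moreover have "g + ?c *s s \<in> vs.span (insert s F)"
      using g(1) subsetD[OF vs.span_mono[of F "insert s F"]]
      by (intro vs.span_add vs.span_scale) (auto intro: vs.span_base)
    ultimately show ?thesis
      by blast
  qed
qed

text \<open>
  For a basis \<open>F\<close> of \<open>I\<close>, the functionals \<open>\<lambda>i. \<omega> i s\<close> with \<open>s \<in> F\<close> have no common zero in \<open>I\<close>
  besides \<open>0\<close>, so \<open>\<lambda>i. \<omega> i w\<close> is represented on \<open>I\<close> by a vector of \<open>I\<close>, the projection of \<open>w\<close>.
\<close>

lemma orthogonal_decomposition:
  assumes "vs.subspace I" "I \<subseteq> V" "I \<inter> orthogonal A I = {0}" "w \<in> V"
  obtains i where "i \<in> I" "w - i \<in> orthogonal A I"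
proof -
  obtain S where "finite S" "V = vs.span S"
    using finite_span by blast
  then obtain F where F: "finite F" "vs.span F = I"
    using vs.subspace_obtain_basis[of S I] assms by metis
  have "F \<subseteq> I"
    using F vs.span_superset by blast
  have "\<omega> i w = 0" if i: "i \<in> I" and *: "\<And>s. s \<in> F \<Longrightarrow> \<omega> i s = 0" for i
  proof -
    have "vs.subspace {s \<in> V. \<omega> i s = 0}"
      using i assms(2) subspace_V by (auto simp: vs.subspace_def)
    then have "vs.span F \<subseteq> {s \<in> V. \<omega> i s = 0}"
      using * \<open>F \<subseteq> I\<close> assms(2) by (intro vs.span_minimal) auto
    then have "i \<in> orthogonal A I"
      using F i assms(2) by (auto simp: orthogonal_def)
    then have "i = 0"
      using i assms(3) by blast
    then show ?thesis
      using assms(4) by simp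
  qed
  then obtain g where g: "g \<in> I" "\<And>i. i \<in> I \<Longrightarrow> \<omega> i w = \<omega> i g"
    using functional_in_span[OF F(1) _ assms(1,2,4)] \<open>F \<subseteq> I\<close> assms(2) F(2) by blast
  have "\<omega> (w - g) i = 0" if "i \<in> I" for i
    using g that assms(2,4) om_skew[of i w] om_skew[of i g] by (auto simp: subset_iff)
  then show thesis
    using that[of g] g(1) assms by (auto simp: orthogonal_def)
qed

section \<open>The Milnor case and the invariant line\<close>

definition kernel :: "'v set" where
  "kernel = {u \<in> V. \<forall>w\<in>V. u \<bullet> w = 0}"

text \<open>
  The part of the kernel that obstructs its being the Milnor ideal; otherwise it supplies the line
  by which the algebra is reduced.
\<close>

definition core :: "'v set" where
  "core = {u \<in> kernel. \<forall>a\<in>V. \<forall>b\<in>V. \<omega> u (comm A a b) = 0}"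

lemma comm_in_kernel: "a \<in> V \<Longrightarrow> b \<in> V \<Longrightarrow> comm A a b \<in> kernel"
  by (simp add: kernel_def comm_def prd_comm_left)

lemma subspace_kernel: "vs.subspace kernel"
  by (auto simp: vs.subspace_def kernel_def)

lemma kernel_in [simp]: "u \<in> kernel \<Longrightarrow> u \<in> V"
  and kernel_prd [simp]: "u \<in> kernel \<Longrightarrow> w \<in> V \<Longrightarrow> u \<bullet> w = 0"
  by (auto simp: kernel_def)

lemma subspace_core: "vs.subspace core"
  using subspace_kernel by (auto simp: vs.subspace_def core_def comm_def)

text \<open>For \<open>u\<close> in the kernel, the product \<open>x \<bullet> u\<close> is the commutator of \<open>x\<close> and \<open>u\<close>.\<close>

lemma prd_kernel: "x \<in> V \<Longrightarrow> u \<in> kernel \<Longrightarrow> x \<bullet> u \<in> kernel"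
  using comm_in_kernel[of x u] by (simp add: comm_def)

text \<open>
  Left multiplication by \<open>x\<close> moves to the other side of the form, where it sends a commutator \<open>c\<close>
  to \<open>x \<bullet> c = [x, c]\<close>, again a commutator because \<open>c\<close> is in the kernel.
\<close>

lemma prd_core:
  assumes x: "x \<in> V" and u: "u \<in> core"
  shows "x \<bullet> u \<in> core"
proof -
  have uk: "u \<in> kernel"
    using u by (simp add: core_def)
  have "\<omega> (x \<bullet> u) (comm A a b) = 0" if ab: "a \<in> V" "b \<in> V" for a b
  proof -
    have c: "comm A a b \<in> kernel"
      using comm_in_kernel ab by blast
    have "\<omega> (x \<bullet> u) (comm A a b) = \<omega> u (comm A x (comm A a b))"
      using c x uk om_prd_left[of x u "comm A a b"] by (simp add: comm_def[of A x])
    then show ?thesis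
      using u x c by (simp add: core_def)
  qed
  then show ?thesis
    using prd_kernel[OF x uk] by (simp add: core_def)
qed

lemma ideal_kernel: "two_sided_ideal A kernel"
  using subspace_kernel prd_kernel vs.subspace_0[OF subspace_kernel]
  by (auto simp: two_sided_ideal_def)

lemma lie_comm: "lie_bracket_on (scale A) V (comm A)"
proof -
  have "bilinear_on (scale A) V (scale A) V (comm A)"
    by (auto simp: bilinear_on_def linear_on_def comm_def vs.scale_right_diff_distrib)
  moreover have "comm A u (comm A v w) + comm A v (comm A w u) + comm A w (comm A u v) = 0"
    if "u \<in> V" "v \<in> V" "w \<in> V" for u v w
  proof -
    have *: "comm A x (comm A y z) = x \<bullet> (y \<bullet> z) - x \<bullet> (z \<bullet> y)"
      if "x \<in> V" "y \<in> V" "z \<in> V" for x y z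
      using kernel_prd[OF comm_in_kernel[of y z], of x] that by (simp add: comm_def)
    show ?thesis
      using that left_mults_commute[of u v w] left_mults_commute[of v w u]
        left_mults_commute[of w u v] by (simp add: *)
  qed
  ultimately show ?thesis
    by (auto simp: lie_bracket_on_def comm_def)
qed

text \<open>
  The kernel contains all commutators, so its intersection with its orthogonal complement lies in
  \<open>core\<close>; if this is \<open>0\<close>, the kernel is nondegenerate. Its orthogonal complement is then a commutative
  subalgebra, and there the trilinear form \<open>\<omega> (x \<bullet> y) z\<close> is symmetric in \<open>x, y\<close> and antisymmetric in
  \<open>y, z\<close>, so it vanishes. A product of arbitrary elements then
  equals one whose right factor is in the kernel, so it is in the kernel.
\<close>

lemma milnor_if_core_trivial:
  assumes "core = {0}"
  shows "milnor_presymplectic A"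
proof -
  let ?P = "orthogonal A kernel"
  have P_iff: "p \<in> ?P \<longleftrightarrow> p \<in> V \<and> (\<forall>n\<in>kernel. \<omega> p n = 0)" for p
    by (auto simp: orthogonal_def)
  have P_in: "p \<in> V" if "p \<in> ?P" for p
    using that by (simp add: P_iff)
  have "kernel \<inter> ?P \<subseteq> core"
    using comm_in_kernel by (auto simp: P_iff core_def)
  moreover have "0 \<in> kernel \<inter> ?P"
    by (simp add: P_iff vs.subspace_0 subspace_kernel)
  ultimately have nondeg: "kernel \<inter> ?P = {0}"
    using assms by blast
  have split: "\<exists>i\<in>kernel. w - i \<in> ?P" if "w \<in> V" for w
    using orthogonal_decomposition[OF subspace_kernel _ nondeg that] kernel_in by blast
  have P_prd: "x \<bullet> y \<in> ?P" if "x \<in> ?P" "y \<in> ?P" for x y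
    using that prd_kernel[of x] P_in by (auto simp: P_iff om_prd_left)
  have P_comm: "x \<bullet> y = y \<bullet> x" if xy: "x \<in> ?P" "y \<in> ?P" for x y
  proof -
    have "comm A x y \<in> ?P"
      using P_prd[of x y] P_prd[of y x] xy by (auto simp: P_iff comm_def)
    then have "comm A x y = 0"
      using nondeg comm_in_kernel[of x y] xy P_in by blast
    then show ?thesis
      by (simp add: comm_def)
  qed
  have P_zero: "x \<bullet> y = 0" if xy: "x \<in> ?P" "y \<in> ?P" for x y
  proof (rule nondegenerate)
    have anti: "\<omega> (a \<bullet> b) c = - \<omega> (a \<bullet> c) b" if "a \<in> ?P" "b \<in> ?P" "c \<in> ?P" for a b c
      using that om_prd_left[of a b c] om_skew[of b "a \<bullet> c"] by (simp add: P_in)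
    fix w assume w: "w \<in> V"
    obtain i where i: "i \<in> kernel" and z: "w - i \<in> ?P"
      using split[OF w] by blast
    let ?z = "w - i"
    have "\<omega> (x \<bullet> y) ?z = - \<omega> (x \<bullet> ?z) y"
      by (rule anti) (fact xy z)+
    also have "\<dots> = - \<omega> (?z \<bullet> x) y"
      by (simp only: P_comm[OF xy(1) z])
    also have "\<dots> = \<omega> (?z \<bullet> y) x"
      by (simp only: anti[OF z xy] minus_minus)
    also have "\<dots> = \<omega> (y \<bullet> ?z) x"
      by (simp only: P_comm[OF xy(2) z])
    also have "\<dots> = - \<omega> (y \<bullet> x) ?z"
      by (rule anti) (fact xy z)+
    also have "\<dots> = - \<omega> (x \<bullet> y) ?z"
      by (simp only: P_comm[OF xy])
    finally have "\<omega> (x \<bullet> y) ?z = 0"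
      by simp
    moreover have "\<omega> (x \<bullet> y) i = 0"
      using P_prd[OF xy] i by (simp add: P_iff)
    ultimately show "\<omega> (x \<bullet> y) w = 0"
      using xy i w P_in by simp
  qed (use xy P_in in auto)
  have "x \<bullet> y \<in> kernel" if xy: "x \<in> V" "y \<in> V" for x y
  proof -
    obtain i j where i: "i \<in> kernel" "x - i \<in> ?P" and j: "j \<in> kernel" "y - j \<in> ?P"
      using split xy by meson
    have "x \<bullet> y = x \<bullet> j + (x - i) \<bullet> (y - j)"
      using xy i(1) j(1) by simp
    then have "x \<bullet> y = x \<bullet> j"
      using P_zero[OF i(2) j(2)] by simp
    then show ?thesis
      using prd_kernel xy j(1) by simp
  qed
  then show ?thesis
    using presymplectic_lsa lie_comm ideal_kernel nondeg
    by (auto simp: milnor_presymplectic_def presymplectic_lsa_def intro!: exI[of _ kernel])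
qed

text \<open>
  Let \<open>\<lambda>\<close> be the weight of \<open>e\<close>. Since \<open>e\<close> is orthogonal to commutators,
  \<open>\<lambda>(x) \<omega>(e,d) = \<omega>(e, x \<bullet> d) = \<omega>(e, d \<bullet> x) = \<lambda>(d) \<omega>(e,x)\<close>. With \<open>\<omega>(e,d) = 1\<close> this shows that the
  weight vanishes on the orthogonal complement of \<open>e\<close>.
\<close>

lemma eigenvector_in_core:
  assumes e: "e \<in> core" "e \<noteq> 0" and eig: "\<And>x. x \<in> V \<Longrightarrow> \<exists>c. x \<bullet> e = c *s e"
  shows "\<exists>d\<in>V. \<omega> e d = 1 \<and> (\<exists>lam. d \<bullet> e = lam *s e) \<and> (\<forall>x\<in>V. \<omega> e x = 0 \<longrightarrow> x \<bullet> e = 0)"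
proof -
  have eV: "e \<in> V"
    using e(1) by (simp add: core_def)
  obtain d' where d': "d' \<in> V" "\<omega> e d' \<noteq> 0"
    using nondegenerate[OF eV] e(2) by blast
  define d where "d = (1 / \<omega> e d') *s d'"
  have d: "d \<in> V" "\<omega> e d = 1"
    using d' eV by (simp_all add: d_def)
  obtain lam where lam: "d \<bullet> e = lam *s e"
    using eig d by blast
  have "x \<bullet> e = 0" if x: "x \<in> V" "\<omega> e x = 0" for x
  proof -
    obtain c where c: "x \<bullet> e = c *s e"
      using eig x(1) by blast
    have "c = \<omega> (x \<bullet> e) d"
      using c d eV by simp
    also have "\<dots> = \<omega> e (x \<bullet> d)"
      using x(1) d(1) eV by (simp add: om_prd_left)
    also have "\<dots> = \<omega> e (d \<bullet> x)"
      using e(1) x(1) d(1) eV by (auto simp: core_def comm_def)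
    also have "\<dots> = \<omega> (d \<bullet> e) x"
      using x(1) d(1) eV by (simp add: om_prd_left)
    also have "\<dots> = 0"
      using lam x eV by simp
    finally show ?thesis
      using c by simp
  qed
  then show ?thesis
    using d lam by blast
qed

end

section \<open>Reduction by a line\<close>

text \<open>
  The quotient of the orthogonal complement of \<open>e\<close> by the line of \<open>e\<close>, realised on the
  complement \<open>{d, e}\<^sup>\<bottom>\<close> of that line so that it lies in the same ambient space.
\<close>

definition reduction ::
  "('k::field, 'v::ab_group_add) form_algebra \<Rightarrow> 'v \<Rightarrow> 'v \<Rightarrow> ('k, 'v) form_algebra" where
  "reduction A e d =
     \<lparr> carrier = {u \<in> carrier A. form A e u = 0 \<and> form A d u = 0},
       scale = scale A,
       mult = (\<lambda>u v. mult A u v - scale A (form A (mult A u v) d) e),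
       form = form A \<rparr>"

locale reducible = presymplectic A
  for A :: "('k::field_char_0, 'v::ab_group_add) form_algebra" +
  fixes e d :: 'v and lam :: 'k
  assumes e [simp]: "e \<in> V" and d [simp]: "d \<in> V" and ed [simp]: "\<omega> e d = 1"
    and e_prd [simp]: "\<And>x. x \<in> V \<Longrightarrow> e \<bullet> x = 0"
    and d_e [simp]: "d \<bullet> e = lam *s e"
    and prd_e: "\<And>x. x \<in> V \<Longrightarrow> \<omega> e x = 0 \<Longrightarrow> x \<bullet> e = 0"
begin

abbreviation B where "B \<equiv> reduction A e d"

definition pr :: "'v \<Rightarrow> 'v" where
  "pr w = w - \<omega> w d *s e"

definition xi :: "'v \<Rightarrow> 'v" where
  "xi u = pr (d \<bullet> u)"

definition b0 :: 'v where
  "b0 = d \<bullet> d - lam *s d"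

lemma B_sel [simp]: "scale B = scale A" "mult B = (\<lambda>u v. pr (u \<bullet> v))" "form B = \<omega>"
  by (simp_all add: reduction_def pr_def)

lemma in_BI: "u \<in> V \<Longrightarrow> \<omega> e u = 0 \<Longrightarrow> \<omega> d u = 0 \<Longrightarrow> u \<in> carrier B"
  by (simp add: reduction_def)

lemma de [simp]: "\<omega> d e = -1"
  using om_skew[of d e] by simp

lemma subspace_B: "vs.subspace (carrier B)"
  by (auto simp: vs.subspace_def reduction_def)

lemma B_V [simp]: "u \<in> carrier B \<Longrightarrow> u \<in> V"
  and B_om [simp]: "u \<in> carrier B \<Longrightarrow> \<omega> e u = 0" "u \<in> carrier B \<Longrightarrow> \<omega> d u = 0"
    "u \<in> carrier B \<Longrightarrow> \<omega> u e = 0" "u \<in> carrier B \<Longrightarrow> \<omega> u d = 0"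
  and B_e [simp]: "u \<in> carrier B \<Longrightarrow> u \<bullet> e = 0"
  using om_skew[of u e] om_skew[of u d] prd_e by (auto simp: reduction_def)

lemma pr_V [simp]: "w \<in> V \<Longrightarrow> pr w \<in> V"
  by (simp add: pr_def)

lemma pr_B: "w \<in> V \<Longrightarrow> \<omega> e w = 0 \<Longrightarrow> pr w \<in> carrier B"
  using om_skew[of d w] by (intro in_BI) (simp_all add: pr_def)

lemma pr_id [simp]: "u \<in> carrier B \<Longrightarrow> pr u = u"
  by (simp add: pr_def)

lemma pr_lin [simp]:
  shows "u \<in> V \<Longrightarrow> v \<in> V \<Longrightarrow> pr (u + v) = pr u + pr v"
    "u \<in> V \<Longrightarrow> v \<in> V \<Longrightarrow> pr (u - v) = pr u - pr v"
    "u \<in> V \<Longrightarrow> pr (c *s u) = c *s pr u" "pr e = 0" "pr 0 = 0"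
  by (simp_all add: pr_def vs.scale_left_distrib vs.scale_left_diff_distrib
      vs.scale_right_diff_distrib)

lemma om_pr [simp]:
  assumes "w \<in> V" "v \<in> carrier B"
  shows "\<omega> (pr w) v = \<omega> w v" "\<omega> v (pr w) = \<omega> v w"
  using assms by (simp_all add: pr_def)

lemma prd_pr [simp]:
  assumes "w \<in> V"
  shows "v \<in> V \<Longrightarrow> pr w \<bullet> v = w \<bullet> v" "u \<in> carrier B \<Longrightarrow> u \<bullet> pr w = u \<bullet> w"
    "pr (d \<bullet> pr w) = pr (d \<bullet> w)"
  using assms by (simp_all add: pr_def[of w])

text \<open>
  By symmetry of left multiplications, \<open>\<omega>(e, x \<bullet> y) = \<omega>(x \<bullet> e, y)\<close>; and \<open>x \<bullet> e\<close> is a multiple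
  of \<open>e\<close> for every \<open>x\<close>, since \<open>x\<close> differs from a multiple of \<open>d\<close> by a vector orthogonal to \<open>e\<close>.
\<close>

lemma e_perp [simp]:
  assumes "x \<in> V"
  shows "\<omega> e x = 0 \<Longrightarrow> y \<in> V \<Longrightarrow> \<omega> e (x \<bullet> y) = 0" "u \<in> carrier B \<Longrightarrow> \<omega> e (x \<bullet> u) = 0"
proof -
  show "\<omega> e (x \<bullet> y) = 0" if "\<omega> e x = 0" "y \<in> V"
    using that assms prd_e[OF assms] om_prd_left[of x e y] by simp
  show "\<omega> e (x \<bullet> u) = 0" if u: "u \<in> carrier B"
  proof -
    have "\<omega> e (x - \<omega> e x *s d) = 0"
      using assms by simp
    from prd_e[OF _ this] have "x \<bullet> e = \<omega> e x *s lam *s e"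
      using assms by simp
    then show ?thesis
      using assms u om_prd_left[of x e u] by simp
  qed
qed

lemma closed_B:
  assumes "u \<in> carrier B"
  shows "v \<in> carrier B \<Longrightarrow> pr (u \<bullet> v) \<in> carrier B" "xi u \<in> carrier B" "u \<bullet> d \<in> carrier B"
proof -
  show "pr (u \<bullet> v) \<in> carrier B" if "v \<in> carrier B"
    using assms that by (intro pr_B) auto
  show "xi u \<in> carrier B"
    using assms unfolding xi_def by (intro pr_B) auto
  show "u \<bullet> d \<in> carrier B"
    using assms om_skew[of d "u \<bullet> d"] by (intro in_BI) simp_all
qed

lemma b0_in_B [simp]: "b0 \<in> carrier B"
proof -
  have "\<omega> e (d \<bullet> d) = lam"
    using om_prd_left[of d e d] by simp
  then show ?thesis
    using om_skew[of d "d \<bullet> d"] by (intro in_BI) (simp_all add: b0_def)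
qed

lemma B_presymplectic: "presymplectic_lsa B"
proof -
  have "\<exists>S. finite S \<and> carrier B = vs.span S"
    using vs.subspace_obtain_basis[OF _ subspace_B] finite_span by (metis B_V subsetI)
  moreover have "bilinear_on (scale A) (carrier B) (scale A) (carrier B) (\<lambda>u v. pr (u \<bullet> v))"
    by (auto simp: bilinear_on_def linear_on_def closed_B)
  ultimately have "fd_algebra B"
    using vector_space by (simp add: fd_algebra_def)
  moreover have "left_symmetric B"
  proof -
    have "pr (pr (u \<bullet> v) \<bullet> w) - pr (u \<bullet> pr (v \<bullet> w)) = pr (pr (v \<bullet> u) \<bullet> w) - pr (v \<bullet> pr (u \<bullet> w))"
      if "u \<in> carrier B" "v \<in> carrier B" "w \<in> carrier B" for u v w
      using that prd_comm_left[of u v w] left_mults_commute[of u v w] by simp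
    then show ?thesis
      by (simp add: left_symmetric_def)
  qed
  moreover have "symplectic_form B"
  proof -
    have "u = 0" if u: "u \<in> carrier B" "\<And>v. v \<in> carrier B \<Longrightarrow> \<omega> u v = 0" for u
    proof (rule nondegenerate)
      fix w assume w: "w \<in> V"
      have "pr (w - \<omega> e w *s d) \<in> carrier B"
        using w by (intro pr_B) auto
      from u(2)[OF this] show "\<omega> u w = 0"
        using u(1) w by simp
    qed (use u in simp)
    moreover have "bilinear_on (scale A) (carrier B) (*) UNIV \<omega>"
      by (auto simp: bilinear_on_def linear_on_def)
    moreover have "\<omega> u v = - \<omega> v u" if "u \<in> carrier B" "v \<in> carrier B" for u v
      using that by (intro om_skew) simp_all
    ultimately show ?thesis
      unfolding symplectic_form_def B_sel by blast
  qed
  moreover have "left_mult_symmetric B"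
    by (simp add: left_mult_symmetric_def om_prd_left)
  ultimately show ?thesis
    by (simp add: presymplectic_lsa_def)
qed

text \<open>
  The description defining the adjoint has only one solution, by nondegeneracy, so the adjoint
  of \<open>T\<close> kills everything orthogonal to the image of \<open>T\<close>.
\<close>

lemma adjoint_eq_0:
  assumes "\<And>u. u \<in> carrier B \<Longrightarrow> \<omega> (T u) v = 0"
  shows "adjoint B T v = 0"
  unfolding adjoint_def
proof (rule the_equality)
  show "0 \<in> carrier B \<and> (\<forall>u\<in>carrier B. form B (T u) v = form B u 0)"
    using assms vs.subspace_0[OF subspace_B] by simp
next
  fix w assume w: "w \<in> carrier B \<and> (\<forall>u\<in>carrier B. form B (T u) v = form B u w)"
  have "form B w u = 0" if "u \<in> carrier B" for u
    using that w assms[of u] om_skew[of w u] by simp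
  then show "w = 0"
    using B_presymplectic w unfolding presymplectic_lsa_def symplectic_form_def by blast
qed

text \<open>
  The algebraic conditions on the data are \<open>prd_comm_left\<close> and \<open>left_mults_commute\<close> with
  some arguments equal to \<open>d\<close>. In the two adjoint conditions, these identities make the form
  symmetric on \<open>v \<bullet> d\<close> and \<open>u \<bullet> d\<close> (respectively \<open>d \<bullet> d\<close>, which differs from \<open>b0\<close> by a multiple
  of \<open>d\<close>); being also skew, it vanishes there.
\<close>

lemma B_data: "double_extension_data B xi (\<lambda>u. u \<bullet> d) b0 lam"
proof -
  have endo: "endo B xi" "endo B (\<lambda>u. u \<bullet> d)"
    using closed_B by (auto simp: endo_def linear_on_def xi_def)
  have symm: "symmetric_endo B xi"
    by (simp add: symmetric_endo_def xi_def om_prd_left)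
  have on_pairs: "comm B u v \<bullet> d = 0" "pr (u \<bullet> (v \<bullet> d)) = pr (v \<bullet> (u \<bullet> d))"
    "pr (u \<bullet> d \<bullet> v) = pr (xi u \<bullet> v)" "xi (pr (u \<bullet> v)) = pr (u \<bullet> xi v)"
    if "u \<in> carrier B" "v \<in> carrier B" for u v
    using that by (simp_all add: comm_def xi_def prd_comm_left[of u v d] prd_comm_left[of u d v]
        left_mults_commute[of u v d] left_mults_commute[of d u v])
  have on_d: "xi (u \<bullet> d) = lam *s (u \<bullet> d) + pr (u \<bullet> b0)"
    "u \<bullet> d \<bullet> d = xi u \<bullet> d" if u: "u \<in> carrier B" for u
  proof -
    have "xi (u \<bullet> d) = pr (u \<bullet> (d \<bullet> d))"
      using u by (simp add: xi_def left_mults_commute[of d u])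
    also have "d \<bullet> d = lam *s d + b0"
      by (simp add: b0_def)
    also have "pr (u \<bullet> \<dots>) = lam *s (u \<bullet> d) + pr (u \<bullet> b0)"
      using u closed_B by simp
    finally show "xi (u \<bullet> d) = lam *s (u \<bullet> d) + pr (u \<bullet> b0)" .
    show "u \<bullet> d \<bullet> d = xi u \<bullet> d"
      using u by (simp add: xi_def prd_comm_left[of u d])
  qed
  have adj: "adjoint B (\<lambda>u. u \<bullet> d) (u \<bullet> d) = 0" if u: "u \<in> carrier B" for u
  proof (rule adjoint_eq_0)
    fix v assume v: "v \<in> carrier B"
    have "\<omega> (v \<bullet> d) (u \<bullet> d) = \<omega> (u \<bullet> d) (v \<bullet> d)"
      using u v by (simp add: om_prd_left left_mults_commute[of u v d])
    then show "\<omega> (v \<bullet> d) (u \<bullet> d) = 0"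
      using om_skew[of "v \<bullet> d" "u \<bullet> d"] u v by simp
  qed
  have adj_b0: "adjoint B (\<lambda>u. u \<bullet> d) b0 = 0"
  proof (rule adjoint_eq_0)
    fix v assume v: "v \<in> carrier B"
    have "\<omega> (v \<bullet> d) (d \<bullet> d) = \<omega> (d \<bullet> d) (v \<bullet> d)"
      using v by (simp add: om_prd_left left_mults_commute[of v d d])
    then have "\<omega> (v \<bullet> d) (d \<bullet> d) = 0"
      using om_skew[of "v \<bullet> d" "d \<bullet> d"] v by simp
    then show "\<omega> (v \<bullet> d) b0 = 0"
      using v by (simp add: b0_def)
  qed
  show ?thesis
    unfolding double_extension_data_def B_sel
    by (intro conjI ballI endo symm b0_in_B on_pairs on_d adj adj_b0)
qed

definition coords :: "'v \<Rightarrow> 'k \<times> 'v \<times> 'k" where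
  "coords w = (\<omega> e w, pr (w - \<omega> e w *s d), \<omega> w d)"

definition combine :: "'k \<times> 'v \<times> 'k \<Rightarrow> 'v" where
  "combine = (\<lambda>(a, u, c). a *s d + u + c *s e)"

abbreviation E where "E \<equiv> double_extension B xi (\<lambda>u. u \<bullet> d) b0 lam"

lemma in_E: "t \<in> carrier E \<longleftrightarrow> fst (snd t) \<in> carrier B"
  by (cases t) (auto simp: double_extension_def)

lemma coords_in: "w \<in> V \<Longrightarrow> coords w \<in> carrier E"
  unfolding in_E coords_def fst_conv snd_conv by (intro pr_B) simp_all

lemma combine_in: "t \<in> carrier E \<Longrightarrow> combine t \<in> V"
  by (cases t) (auto simp: in_E combine_def)

lemma combine_coords: "w \<in> V \<Longrightarrow> combine (coords w) = w"
  by (simp add: combine_def coords_def pr_def)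

lemma coords_combine: "t \<in> carrier E \<Longrightarrow> coords (combine t) = t"
  by (cases t) (auto simp: in_E combine_def coords_def)

lemma combine_mult:
  assumes "t \<in> carrier E" "t' \<in> carrier E"
  shows "combine (mult E t t') = combine t \<bullet> combine t'"
proof -
  obtain a u c a' u' c' where t: "t = (a, u, c)" "t' = (a', u', c')"
    by (cases t, cases t') auto
  have u: "u \<in> carrier B" "u' \<in> carrier B"
    using assms by (auto simp: t in_E)
  have dd: "d \<bullet> d = lam *s d + b0"
    by (simp add: b0_def)
  have "\<omega> (d \<bullet> u') d = \<omega> u' b0"
    using u by (simp add: om_prd_left dd)
  then have du: "d \<bullet> u' = xi u' + (- \<omega> b0 u') *s e"
    using u om_skew[of u' b0] by (simp add: xi_def pr_def)
  have "\<omega> (u \<bullet> u') d = - \<omega> (u \<bullet> d) u'"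
    using u om_prd_left[of u u' d] om_skew[of u' "u \<bullet> d"] by simp
  then have uu: "u \<bullet> u' = pr (u \<bullet> u') + (- \<omega> (u \<bullet> d) u') *s e"
    using u by (simp add: pr_def)
  have "combine t \<bullet> combine t' =
    a *s (a' *s (d \<bullet> d) + d \<bullet> u' + c' *s (d \<bullet> e)) + (a' *s (u \<bullet> d) + u \<bullet> u')"
    using u by (simp add: t combine_def algebra_simps)
  also have "\<dots> = combine (mult E t t')"
    by (subst du, subst uu, subst dd)
      (simp add: t combine_def double_extension_def algebra_simps)
  finally show ?thesis ..
qed

lemma combine_form:
  assumes "t \<in> carrier E" "t' \<in> carrier E"
  shows "form E t t' = \<omega> (combine t) (combine t')"
  using assms by (cases t; cases t') (auto simp: in_E combine_def double_extension_def)

lemma combine_lin: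
  "combine (t + t') = combine t + combine t'" "combine (scale E r t) = r *s combine t"
  by (cases t; cases t'; simp add: combine_def double_extension_def algebra_simps)+

lemma is_double_extension: "is_double_extension A B"
proof -
  have E_add: "t + t' \<in> carrier E" if "t \<in> carrier E" "t' \<in> carrier E" for t t'
    using that vs.subspace_add[OF subspace_B] by (simp add: in_E)
  have E_scale: "scale E r t \<in> carrier E" if "t \<in> carrier E" for t r
    using that vs.subspace_scale[OF subspace_B]
    by (cases t) (simp add: in_E, simp add: double_extension_def)
  have E_mult: "mult E t t' \<in> carrier E" if "t \<in> carrier E" "t' \<in> carrier E" for t t'
    using that closed_B vs.subspace_add[OF subspace_B] vs.subspace_scale[OF subspace_B]
    by (cases t; cases t') (simp add: in_E, simp add: double_extension_def)
  have "linear_on (scale A) V (scale E) (carrier E) coords"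
  proof -
    have "coords (u + v) = coords u + coords v" if "u \<in> V" "v \<in> V" for u v
      using coords_combine[OF E_add[OF coords_in coords_in, of u v]] that
      by (simp only: combine_lin combine_coords)
    moreover have "coords (c *s u) = scale E c (coords u)" if "u \<in> V" for c u
      using coords_combine[OF E_scale[OF coords_in, of u c]] that
      by (simp only: combine_lin combine_coords)
    ultimately show ?thesis
      using coords_in by (simp only: linear_on_def) blast
  qed
  moreover have "bij_betw coords V (carrier E)"
    by (rule bij_betw_byWitness[where f' = combine])
      (auto simp: coords_in combine_in combine_coords coords_combine)
  moreover have "coords (u \<bullet> v) = mult E (coords u) (coords v) \<and>
    form E (coords u) (coords v) = \<omega> u v" if uv: "u \<in> V" "v \<in> V" for u v
  proof
    show "coords (u \<bullet> v) = mult E (coords u) (coords v)"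
      using coords_combine[OF E_mult[OF coords_in coords_in, of u v]] uv
      by (simp only: combine_mult coords_in combine_coords)
    show "form E (coords u) (coords v) = \<omega> u v"
      using uv by (simp only: combine_form coords_in combine_coords)
  qed
  ultimately have "isomorphic A E"
    unfolding isomorphic_def by blast
  then show ?thesis
    unfolding is_double_extension_def using B_data by blast
qed

end

section \<open>The structure theorem\<close>

lemma milnor_or_double_extension:
  fixes A :: "('k::{alg_closed_field, field_char_0}, 'v::ab_group_add) form_algebra"
  assumes "presymplectic_lsa A" "\<not> milnor_presymplectic A"
    and S: "finite S" "carrier A = module.span (scale A) S"
  obtains B :: "('k, 'v) form_algebra" and S' where
    "presymplectic_lsa B" "is_double_extension A B"
    "finite S'" "carrier B = module.span (scale B) S'" "card S' < card S"
proof -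
  interpret presymplectic A
    by unfold_locales fact
  have "core \<noteq> {0}"
    using milnor_if_core_trivial assms(2) by blast
  have core_V: "core \<subseteq> V"
    by (auto simp: core_def)
  obtain F where F: "finite F" "vs.span F = core"
    by (rule vs.subspace_obtain_basis[OF S(1) subspace_core core_V[unfolded S(2)]])
  have "linear_on (scale A) core (scale A) core (mult A x)" if x: "x \<in> V" for x
    using prd_core[OF x] x subsetD[OF core_V] by (simp add: linear_on_def)
  moreover have "x \<bullet> (y \<bullet> w) = y \<bullet> (x \<bullet> w)" if "x \<in> V" "y \<in> V" "w \<in> core" for x y w
    using that core_V by (intro left_mults_commute) auto
  ultimately have "\<exists>e\<in>core. e \<noteq> 0 \<and> (\<forall>x\<in>V. \<exists>c. x \<bullet> e = c *s e)"
    by (rule common_eigenvector_exists[OF vector_space F(1) F(2)[symmetric] \<open>core \<noteq> {0}\<close>])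
  then obtain e where e: "e \<in> core" "e \<noteq> 0" "\<And>x. x \<in> V \<Longrightarrow> \<exists>c. x \<bullet> e = c *s e"
    by blast
  obtain d lam where "d \<in> V" "\<omega> e d = 1" "d \<bullet> e = lam *s e"
    "\<And>x. x \<in> V \<Longrightarrow> \<omega> e x = 0 \<Longrightarrow> x \<bullet> e = 0"
    using eigenvector_in_core[OF e] by blast
  moreover have "e \<in> V" "\<And>x. x \<in> V \<Longrightarrow> e \<bullet> x = 0"
    using e(1) by (simp_all add: core_def)
  ultimately interpret reducible A e d lam
    by unfold_locales
  have "carrier B \<subseteq> vs.span S" "d \<in> vs.span S" "d \<notin> carrier B"
    using S(2) d B_V B_om(1)[of d] ed by auto
  then obtain S' where "finite S'" "vs.span S' = carrier B" "card S' < card S"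
    by (rule vs.proper_subspace_obtain_basis[OF S(1) subspace_B])
  then show thesis
    by (intro that[OF B_presymplectic is_double_extension]) simp_all
qed

theorem mainTheorem13:
  fixes A :: "('k::{alg_closed_field, field_char_0}, 'v::ab_group_add) form_algebra"
  assumes "presymplectic_lsa A"
  shows "milnor_presymplectic A \<or>
    (\<exists>n\<ge>1. \<exists>\<A> :: nat \<Rightarrow> ('k, 'v) form_algebra.
       (\<forall>k\<le>n. presymplectic_lsa (\<A> k)) \<and>
       milnor_presymplectic (\<A> 0) \<and>
       (\<forall>k\<in>{1..n}. is_double_extension (\<A> k) (\<A> (k - 1))) \<and>
       \<A> n = A)"
proof -
  let ?chain = "\<lambda>(n::nat) \<A>. (\<forall>k\<le>n. presymplectic_lsa (\<A> k)) \<and> milnor_presymplectic (\<A> 0) \<and>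
    (\<forall>k\<in>{1..n}. is_double_extension (\<A> k) (\<A> (k - 1)))"
  have chain: "\<exists>n. \<exists>\<A> :: nat \<Rightarrow> ('k, 'v) form_algebra. ?chain n \<A> \<and> \<A> n = A"
    if "presymplectic_lsa A" "finite S" "carrier A = module.span (scale A) S"
    for S and A :: "('k, 'v) form_algebra"
    using that
  proof (induction "card S" arbitrary: S A rule: less_induct)
    case less
    show ?case
    proof (cases "milnor_presymplectic A")
      case True
      then have "?chain 0 (\<lambda>_. A) \<and> A = A"
        using less.prems by auto
      then show ?thesis
        by (intro exI)
    next
      case False
      obtain B :: "('k, 'v) form_algebra" and S' where
        B: "presymplectic_lsa B" "is_double_extension A B"
        and S': "finite S'" "carrier B = module.span (scale B) S'" "card S' < card S"
        by (rule milnor_or_double_extension[OF less.prems(1) False less.prems(2,3)])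
      obtain n \<A> where \<A>: "?chain n \<A>" "\<A> n = B"
        using less.hyps[OF S'(3) B(1) S'(1,2)] by blast
      let ?C = "\<A>(Suc n := A)"
      have "presymplectic_lsa (?C k)" if "k \<le> Suc n" for k
        using that \<A>(1) less.prems(1) by (cases "k = Suc n") simp_all
      moreover have "milnor_presymplectic (?C 0)"
        using \<A>(1) by simp
      moreover have "is_double_extension (?C k) (?C (k - 1))" if "k \<in> {1..Suc n}" for k
      proof (cases "k = Suc n")
        case True
        then show ?thesis
          using \<A>(2) B(2) by simp
      next
        case False
        then have "k \<in> {1..n}" "k - 1 \<noteq> Suc n"
          using that by auto
        then show ?thesis
          using \<A>(1) False by simp
      qed
      ultimately have "?chain (Suc n) ?C \<and> ?C (Suc n) = A"
        by simp
      then show ?thesis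
        by (intro exI)
    qed
  qed
  obtain S where "finite S" "carrier A = module.span (scale A) S"
    using assms by (auto simp: presymplectic_lsa_def fd_algebra_def)
  then obtain n \<A> where \<A>: "?chain n \<A>" "\<A> n = A"
    using chain assms by blast
  show ?thesis
  proof (cases n)
    case 0
    then show ?thesis
      using \<A> by auto
  next
    case (Suc m)
    then have "n \<ge> 1"
      by simp
    with \<A> show ?thesis
      by (intro disjI2 exI[of _ n] exI[of _ \<A>] conjI) simp_all
  qed
qed

end
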